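(* Let $G$ be a group, $M$ a right $\mathbb Z[G]$-module, $\varphi:G\to Z(G)$ a group homomorphism into the center of $G$, $X=M\times G$ the $G$-Alexander biquandle of $(M,\varphi)$, regarded also as an $X$-set with action $*:=\underline{*}$, and $A$ an abelian group. Below, $m_i':=m_i-m_{i+1}$. (1) Let $f:M^3\to A$ be a $G$-invariant multilinear map. The birack $2$-cocycle $\Phi_f=f\circ\psi_2\circ\gamma_2:C_2^{\rm BR}(X;\mathbb Z)_X\to A$ is given by $$\Phi_f((m_0,g_0),(m_1,g_1),(m_2,g_2))=f\bigl(m_0'(1-\varphi(g_1)^{-1}g_1),\;m_1',\;m_2(1-\varphi(g_2)g_2^{-1})\bigr)$$ for all $((m_0,g_0),(m_1,g_1),(m_2,g_2))\in X\times X^2$. (2) Let $f:M^4\to A$ be a $G$-invariant multilinear map. The birack $3$-cocycle $\Phi_f=f\circ\psi_3\circ\gamma_3:C_3^{\rm BR}(X;\mathbb Z)_X\to A$ is given by $$\begin{aligned}\Phi_f((m_0,g_0),(m_1,g_1),(m_2,g_2),(m_3,g_3))=\;&f\bigl(m_0'(1-\varphi(g_1)^{-1}g_1),\,m_1',\,m_2',\,m_3(1-\varphi(g_3)g_3^{-1})\bigr)\\&-f\bigl(m_0'(1-\varphi(g_1)^{-1}g_1)g_2,\,m_1'g_2,\,m_2'\varphi(g_2),\,m_3(1-\varphi(g_3)g_3^{-1})\varphi(g_2)\bigr)\end{aligned}$$ for all $((m_0,g_0),(m_1,g_1),(m_2,g_2),(m_3,g_3))\in X\times X^3$.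
   Context: **$G$-Alexander biquandle.** $X=M\times G$ with the operations $(m,g)\,\underline{*}\,(n,h)=(mh+n(\varphi(h)-h),\,h^{-1}gh)$ and $(m,g)\,\overline{*}\,(n,h)=(m\varphi(h),\,g)$. **$G$-invariant multilinear maps.** Multilinear means additive in each variable. $f:M^n\to A$ is $G$-invariant if $f(m_1g,\dots,m_ng)=f(m_1,\dots,m_n)$ for all $g\in G$. Such an $f$ induces a homomorphism, also denoted $f:C_n^{\rm gp}(M;\mathbb Z)_G\to A$, which is a group $n$-cocycle. **Birack complex with the $X$-set $X$.** $C_n^{\rm BR}(X;\mathbb Z)_X$ is the free abelian group on $X\times X^n$, with generators $(x_0,x_1,\dots,x_n)$, for $n\ge1$, and $0$ otherwise. For $n\ge2$, $$\partial_n^{\rm BR}(x_0,x_1,\dots,x_n)=\sum_{i=1}^n(-1)^{i-1}\{(x_0,\dots,x_{i-1},x_{i+1},\dots,x_n)-(x_0\underline{*}x_i,x_1\underline{*}x_i,\dots,x_{i-1}\underline{*}x_i,x_{i+1}\overline{*}x_i,\dots,x_n\overline{*}x_i)\}.$$ A birack $n$-cocycle (with $X$-set $X$) is a homomorphism $\Phi:C_n^{\rm BR}(X;\mathbb Z)_X\to A$ with $\Phi\circ\partial_{n+1}^{\rm BR}=0$. **Group chains.** $C_n^{\rm gp}(M;\mathbb Z)_G$ is the free abelian group on $M^n$ ($n\ge1$) modulo all $(m_1g,\dots,m_ng)-(m_1,\dots,m_n)$, $g\in G$. **The maps.** $C_n^{\rm BR_U}(X;\mathbb Z)_X$ is, for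 $n\ge1$, the free abelian group on $G^{n+1}\times M^{n+1}$, with generators written $(g_0,\dots,g_n;m_0,\dots,m_n)$. The homomorphism $\gamma_n:C_n^{\rm BR}(X;\mathbb Z)_X\to C_n^{\rm BR_U}(X;\mathbb Z)_X$ is $$\gamma_n((m_0,g_0),\dots,(m_n,g_n))=(g_0,\dots,g_n;\,m_0-m_1,\dots,m_{n-1}-m_n,\,m_n).$$ The homomorphism $\psi_n:C_n^{\rm BR_U}(X;\mathbb Z)_X\to C_{n+1}^{\rm gp}(M;\mathbb Z)_G$ is $$\psi_n(g_0,\dots,g_n;m_0,\dots,m_n)=\sum_{k\in\{0,1\}^n}(-1)^{k_1+\cdots+k_n}(m_0\bm g_{k,0},m_1\bm g_{k,1},\dots,m_n\bm g_{k,n}),$$ where $k=(k_1,\dots,k_n)$, $\bm g_{k,0}=g_1^{k_1}\cdots g_n^{k_n}$ and $\bm g_{k,i}=\varphi(g_1^{k_1}\cdots g_i^{k_i})\,g_{i+1}^{k_{i+1}}\cdots g_n^{k_n}$ for $1\le i\le n$. *)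

theory Defs
  imports "HOL-Algebra.Free_Abelian_Groups" "HOL-Algebra.Generated_Groups"
begin

text \<open>
  The group $G$ is a type of class \<^class>\<open>group_add\<close>. This class does not assume commutativity: the
  group law of the (arbitrary) group $G$ is merely written additively, so that $gh$ is \<open>g + h\<close>,
  $g^{-1}$ is \<open>- g\<close> and the identity is \<open>0\<close>. With this convention the group ring $\mathbb Z[G]$ is the
  type \<open>'g \<Rightarrow>\<^sub>0 int\<close> of finitely supported functions, whose multiplication is convolution.
\<close>

definition gr :: "'g \<Rightarrow> ('g \<Rightarrow>\<^sub>0 int)"
  where "gr g = Poly_Mapping.single g 1"

definition group_center :: "'g::group_add set"
  where "group_center = {z. \<forall>g. z + g = g + z}"

locale right_module =
  fixes smul :: "'m::ab_group_add \<Rightarrow> 'r::ring_1 \<Rightarrow> 'm"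
  assumes smul_add_left: "smul (m + n) r = smul m r + smul n r"
    and smul_add_right: "smul m (r + s) = smul m r + smul m s"
    and smul_mult: "smul m (r * s) = smul (smul m r) s"
    and smul_one: "smul m 1 = m"

text \<open>The operations of the $G$-Alexander biquandle on $X = M \times G$. In \<open>gr (\<phi> h) - gr h\<close> the
  difference is taken in $\mathbb Z[G]$, whereas \<open>- h + g + h\<close> is the conjugate $h^{-1}gh$ in $G$.\<close>

fun under :: "('m::ab_group_add \<Rightarrow> ('g::group_add \<Rightarrow>\<^sub>0 int) \<Rightarrow> 'm) \<Rightarrow> ('g \<Rightarrow> 'g)
    \<Rightarrow> 'm \<times> 'g \<Rightarrow> 'm \<times> 'g \<Rightarrow> 'm \<times> 'g"
  where "under smul \<phi> (m, g) (n, h) = (smul m (gr h) + smul n (gr (\<phi> h) - gr h), - h + g + h)"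

fun over :: "('m::ab_group_add \<Rightarrow> ('g::group_add \<Rightarrow>\<^sub>0 int) \<Rightarrow> 'm) \<Rightarrow> ('g \<Rightarrow> 'g)
    \<Rightarrow> 'm \<times> 'g \<Rightarrow> 'm \<times> 'g \<Rightarrow> 'm \<times> 'g"
  where "over smul \<phi> (m, g) (n, h) = (smul m (gr (\<phi> h)), g)"

text \<open>Tuples are lists, indexed from \<open>0\<close>. A map on $n$-tuples is a function on lists of which only the
  values on lists of length $n$ matter.\<close>

definition multilinear :: "nat \<Rightarrow> ('m::ab_group_add list \<Rightarrow> 'a::ab_group_add) \<Rightarrow> bool"
  where "multilinear n f \<longleftrightarrow>
    (\<forall>ms i u v. length ms = n \<and> i < n \<longrightarrow> f (ms[i := u + v]) = f (ms[i := u]) + f (ms[i := v]))"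

definition G_invariant ::
    "('m::ab_group_add \<Rightarrow> ('g::group_add \<Rightarrow>\<^sub>0 int) \<Rightarrow> 'm) \<Rightarrow> nat \<Rightarrow> ('m list \<Rightarrow> 'a) \<Rightarrow> bool"
  where "G_invariant smul n f \<longleftrightarrow>
    (\<forall>ms g. length ms = n \<longrightarrow> f (map (\<lambda>m. smul m (gr g)) ms) = f ms)"

text \<open>The additive group of the type \<open>'a\<close>, as a target for homomorphisms between group records.\<close>

definition type_group :: "'a::ab_group_add monoid"
  where "type_group = \<lparr>carrier = UNIV, monoid.mult = (+), one = 0\<rparr>"

text \<open>The extension of \<open>f\<close> to a homomorphism on the free abelian group; \<open>[^]\<close> denotes integer multiples.\<close>

definition lin_ext :: "('b \<Rightarrow> 'a::ab_group_add) \<Rightarrow> ('b \<Rightarrow>\<^sub>0 int) \<Rightarrow> 'a"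
  where "lin_ext f c = (\<Sum>x\<in>Poly_Mapping.keys c. f x [^]\<^bsub>type_group\<^esub> Poly_Mapping.lookup c x)"

definition BR_gens :: "nat \<Rightarrow> ('m \<times> 'g) list set"
  where "BR_gens n = {xs. n \<ge> 1 \<and> length xs = Suc n}"

definition C_BR :: "nat \<Rightarrow> (('m \<times> 'g) list \<Rightarrow>\<^sub>0 int) monoid"
  where "C_BR n = free_Abelian_group (BR_gens n)"

definition BR_boundary ::
    "('m::ab_group_add \<Rightarrow> ('g::group_add \<Rightarrow>\<^sub>0 int) \<Rightarrow> 'm) \<Rightarrow> ('g \<Rightarrow> 'g) \<Rightarrow> nat
      \<Rightarrow> (('m \<times> 'g) list \<Rightarrow>\<^sub>0 int) \<Rightarrow> (('m \<times> 'g) list \<Rightarrow>\<^sub>0 int)"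
  where "BR_boundary smul \<phi> n = frag_extend (\<lambda>xs. if n \<ge> 2 then
      (\<Sum>i=1..n. frag_cmul ((-1) ^ (i - 1))
        (frag_of (take i xs @ drop (Suc i) xs)
         - frag_of (map (\<lambda>y. under smul \<phi> y (xs ! i)) (take i xs)
                    @ map (\<lambda>y. over smul \<phi> y (xs ! i)) (drop (Suc i) xs))))
      else 0)"

definition birack_cocycle ::
    "('m::ab_group_add \<Rightarrow> ('g::group_add \<Rightarrow>\<^sub>0 int) \<Rightarrow> 'm) \<Rightarrow> ('g \<Rightarrow> 'g) \<Rightarrow> nat
      \<Rightarrow> ((('m \<times> 'g) list \<Rightarrow>\<^sub>0 int) \<Rightarrow> 'a::ab_group_add) \<Rightarrow> bool"
  where "birack_cocycle smul \<phi> n \<Phi> \<longleftrightarrow>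
    \<Phi> \<in> hom (C_BR n) type_group \<and>
    (\<forall>c \<in> carrier (C_BR (Suc n)). \<Phi> (BR_boundary smul \<phi> (Suc n) c) = 0)"

definition gp_gens :: "nat \<Rightarrow> 'm list set"
  where "gp_gens n = {ms. n \<ge> 1 \<and> length ms = n}"

definition gp_rels ::
    "('m::ab_group_add \<Rightarrow> ('g::group_add \<Rightarrow>\<^sub>0 int) \<Rightarrow> 'm) \<Rightarrow> nat \<Rightarrow> ('m list \<Rightarrow>\<^sub>0 int) set"
  where "gp_rels smul n = generate (free_Abelian_group (gp_gens n))
    {frag_of (map (\<lambda>m. smul m (gr g)) ms) - frag_of ms | ms g. ms \<in> gp_gens n}"

definition C_gp ::
    "('m::ab_group_add \<Rightarrow> ('g::group_add \<Rightarrow>\<^sub>0 int) \<Rightarrow> 'm) \<Rightarrow> nat \<Rightarrow> ('m list \<Rightarrow>\<^sub>0 int) set monoid"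
  where "C_gp smul n = free_Abelian_group (gp_gens n) Mod gp_rels smul n"

definition gp_class ::
    "('m::ab_group_add \<Rightarrow> ('g::group_add \<Rightarrow>\<^sub>0 int) \<Rightarrow> 'm) \<Rightarrow> nat \<Rightarrow> ('m list \<Rightarrow>\<^sub>0 int) \<Rightarrow> ('m list \<Rightarrow>\<^sub>0 int) set"
  where "gp_class smul n c = gp_rels smul n #>\<^bsub>free_Abelian_group (gp_gens n)\<^esub> c"

text \<open>The map on \<^const>\<open>C_gp\<close> induced by \<open>f\<close>: if \<open>f\<close> is $G$-invariant, then \<open>lin_ext f\<close> is constant
  on each coset.\<close>

definition gp_induced :: "('m list \<Rightarrow> 'a::ab_group_add) \<Rightarrow> ('m list \<Rightarrow>\<^sub>0 int) set \<Rightarrow> 'a"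
  where "gp_induced f C = the_elem (lin_ext f ` C)"

text \<open>A generator $(g_0,\dots,g_n;m_0,\dots,m_n)$ is the pair of the lists of its $g_i$ and its $m_i$.\<close>

definition BRU_gens :: "nat \<Rightarrow> ('g list \<times> 'm list) set"
  where "BRU_gens n = {(gs, ms). n \<ge> 1 \<and> length gs = Suc n \<and> length ms = Suc n}"

definition C_BRU :: "nat \<Rightarrow> ('g list \<times> 'm list \<Rightarrow>\<^sub>0 int) monoid"
  where "C_BRU n = free_Abelian_group (BRU_gens n)"

definition gamma_map ::
    "nat \<Rightarrow> (('m::ab_group_add \<times> 'g) list \<Rightarrow>\<^sub>0 int) \<Rightarrow> ('g list \<times> 'm list \<Rightarrow>\<^sub>0 int)"
  where "gamma_map n = frag_extend (\<lambda>xs. frag_of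
    (map snd xs, map (\<lambda>i. fst (xs ! i) - fst (xs ! Suc i)) [0..<n] @ [fst (xs ! n)]))"

text \<open>The product $g_a^{k_a} \cdots g_b^{k_b}$, in this order, for exponents $k_j \in \{0,1\}$. The list
  \<open>ks\<close> is $(k_1,\dots,k_n)$, so $k_j$ is \<open>ks ! (j - 1)\<close>.\<close>

definition kprod :: "'g::group_add list \<Rightarrow> nat list \<Rightarrow> nat \<Rightarrow> nat \<Rightarrow> 'g"
  where "kprod gs ks a b =
    sum_list (map (\<lambda>j. if ks ! (j - 1) = 0 then 0 else gs ! j) [a..<Suc b])"

definition gk :: "('g::group_add \<Rightarrow> 'g) \<Rightarrow> nat \<Rightarrow> 'g list \<Rightarrow> nat list \<Rightarrow> nat \<Rightarrow> 'g"
  where "gk \<phi> n gs ks i =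
    (if i = 0 then kprod gs ks 1 n else \<phi> (kprod gs ks 1 i) + kprod gs ks (Suc i) n)"

definition psi_map ::
    "('m::ab_group_add \<Rightarrow> ('g::group_add \<Rightarrow>\<^sub>0 int) \<Rightarrow> 'm) \<Rightarrow> ('g \<Rightarrow> 'g) \<Rightarrow> nat
      \<Rightarrow> ('g list \<times> 'm list \<Rightarrow>\<^sub>0 int) \<Rightarrow> ('m list \<Rightarrow>\<^sub>0 int) set"
  where "psi_map smul \<phi> n c = gp_class smul (Suc n) (frag_extend (\<lambda>(gs, ms).
    (\<Sum>ks \<in> {ks. length ks = n \<and> set ks \<subseteq> {0, 1}}. frag_cmul ((-1) ^ sum_list ks)
      (frag_of (map (\<lambda>i. smul (ms ! i) (gr (gk \<phi> n gs ks i))) [0..<Suc n])))) c)"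

definition Phi_map ::
    "('m::ab_group_add \<Rightarrow> ('g::group_add \<Rightarrow>\<^sub>0 int) \<Rightarrow> 'm) \<Rightarrow> ('g \<Rightarrow> 'g) \<Rightarrow> nat
      \<Rightarrow> ('m list \<Rightarrow> 'a::ab_group_add) \<Rightarrow> (('m \<times> 'g) list \<Rightarrow>\<^sub>0 int) \<Rightarrow> 'a"
  where "Phi_map smul \<phi> n f = gp_induced f \<circ> psi_map smul \<phi> n \<circ> gamma_map n"

end

theory Submission
  imports Defs
begin

text \<open>
  Write $a_i = m_i - m_{i+1}$ for $i < n$ and $a_n = m_n$, and for $k \in \{0,1\}^n$ write
  $p_j = g_j^{k_j}$. The summand of $\psi_n \gamma_n$ at $k$ is then, up to sign, the tuple
  \<open>twist ps as\<close> with entries $a_i\, \varphi(p_1 \cdots p_i)\, p_{i+1} \cdots p_n$.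

  The reason that $f \circ \psi_n \circ \gamma_n$ is a cocycle is the same for every $n \ge 1$. The two
  faces of a birack generator at position $i$ are one operation depending on an element $h \in G$,
  taken at the identity and at $h = g_i$ (lemma \<open>face_0\<close>). Twisting such a face gives the tuple that one
  obtains by inserting $h$ into the $p_j$ at position $i$, twisting, and then adding two neighbouring
  entries (lemma \<open>twist_diff_face\<close>; centrality of $\varphi$ enters here). The difference of
  the two faces therefore collects the summands with $k_i = 0$ and with $k_i = 1$ into a sum over
  $\{0,1\}^{n+1}$ (lemma \<open>cochain_face_difference\<close>). By multilinearity, adding the entries $i$ and
  $i+1$ of an $(n+2)$-tuple changes the value of $f$ into a sum of its values on the tuples without
  entry $i$ and without entry $i+1$, so the alternating sum over $i$ telescopes, and only the tuples
  without their first and without their last entry remain (lemma \<open>alternating_sum_merge\<close>). In the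
  former all entries carry the factor $\varphi(p_1)$, in the latter all carry the factor $p_{n+1}$. By
  $G$-invariance the terms with $k_1 = 0$ and $k_1 = 1$ cancel in pairs, and likewise those with
  $k_{n+1} = 0$ and $k_{n+1} = 1$.

  For the closed formulas one lets $\varphi(p_1) p_n$ act by its inverse on every entry of the twisted
  tuple. Afterwards $p_1$ occurs in the first entry and $p_n$ in the last entry only, so multilinearity
  in these two entries sums the four terms for $(k_1, k_n)$ to a single value of $f$. No exponent is
  left for $n = 2$; for $n = 3$ the two values of $k_2$ give the two terms.
\<close>

section \<open>Linear extension from the generators of a free abelian group\<close>

lemma comm_group_type_group: "comm_group (type_group :: 'a::ab_group_add monoid)"
proof (rule comm_groupI)
  show "\<exists>y\<in>carrier type_group. y \<otimes>\<^bsub>type_group\<^esub> x = \<one>\<^bsub>type_group\<^esub>" for x :: 'a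
    by (rule bexI[of _ "- x"]) (auto simp: type_group_def)
qed (auto simp: type_group_def algebra_simps)

lemma type_group_simps [simp]:
  "carrier type_group = UNIV" "x \<otimes>\<^bsub>type_group\<^esub> y = x + y" "\<one>\<^bsub>type_group\<^esub> = 0"
  by (auto simp: type_group_def)

lemma multiple_add:
  "(x :: 'a::ab_group_add) [^]\<^bsub>type_group\<^esub> (i + j :: int)
     = x [^]\<^bsub>type_group\<^esub> i + x [^]\<^bsub>type_group\<^esub> j"
proof -
  interpret comm_group "type_group :: 'a monoid" by (rule comm_group_type_group)
  show ?thesis using int_pow_mult[of x i j] by simp
qed

lemma multiple_one: "(x :: 'a::ab_group_add) [^]\<^bsub>type_group\<^esub> (1 :: int) = x"
proof -
  interpret comm_group "type_group :: 'a monoid" by (rule comm_group_type_group)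
  show ?thesis using int_pow_1[of x] by simp
qed

lemma multiple_zero: "(0 :: 'a::ab_group_add) [^]\<^bsub>type_group\<^esub> (i :: int) = 0"
proof -
  interpret comm_group "type_group :: 'a monoid" by (rule comm_group_type_group)
  show ?thesis using int_pow_one[of i] by simp
qed

text \<open>Sums of chains have varying supports; over a common finite superset of the supports the
  extension is visibly additive in the coefficients.\<close>
lemma lin_ext_superset:
  assumes "finite S" "Poly_Mapping.keys c \<subseteq> S"
  shows "lin_ext f c = (\<Sum>x\<in>S. f x [^]\<^bsub>type_group\<^esub> Poly_Mapping.lookup c x)"
  unfolding lin_ext_def
  by (rule sum.mono_neutral_left) (use assms in \<open>auto simp: in_keys_iff\<close>)

lemma lin_ext_zero [simp]: "lin_ext f 0 = 0"
  by (simp add: lin_ext_def)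

lemma lin_ext_add: "lin_ext f (a + b) = lin_ext f a + lin_ext f b"
proof -
  let ?S = "Poly_Mapping.keys a \<union> Poly_Mapping.keys b"
  have "Poly_Mapping.keys (a + b) \<subseteq> ?S" by (rule Poly_Mapping.keys_add)
  then show ?thesis
    by (simp add: lin_ext_superset[of ?S] lookup_add multiple_add sum.distrib)
qed

lemma lin_ext_minus: "lin_ext f (- a) = - lin_ext f a"
  using lin_ext_add[of f "- a" a] by (simp add: eq_neg_iff_add_eq_0)

lemma lin_ext_diff: "lin_ext f (a - b) = lin_ext f a - lin_ext f b"
  using lin_ext_add[of f a "- b"] by (simp add: lin_ext_minus)

lemma lin_ext_sum: "lin_ext f (\<Sum>i\<in>I. c i) = (\<Sum>i\<in>I. lin_ext f (c i))"
  by (induction I rule: infinite_finite_induct) (auto simp: lin_ext_add)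

lemma lin_ext_frag_of [simp]: "lin_ext f (frag_of x) = f x"
  by (simp add: lin_ext_def multiple_one)

lemma lin_ext_eq_zero:
  assumes "\<And>x. x \<in> Poly_Mapping.keys c \<Longrightarrow> f x = 0"
  shows "lin_ext f c = 0"
  unfolding lin_ext_def by (rule sum.neutral) (simp add: assms multiple_zero)

lemma lin_ext_frag_extend:
  "lin_ext f (frag_extend b c) = lin_ext (\<lambda>x. lin_ext f (b x)) c"
proof (rule frag_induction[of c UNIV])
  show "lin_ext f (frag_extend b (x - y)) = lin_ext (\<lambda>x. lin_ext f (b x)) (x - y)"
    if "lin_ext f (frag_extend b x) = lin_ext (\<lambda>x. lin_ext f (b x)) x"
      "lin_ext f (frag_extend b y) = lin_ext (\<lambda>x. lin_ext f (b x)) y" for x y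
    using that by (simp add: frag_extend_diff lin_ext_diff)
qed auto

text \<open>The scalar $(-1)^k$ on an abelian group that need not be a ring.\<close>
definition signed :: "nat \<Rightarrow> 'a::ab_group_add \<Rightarrow> 'a"
  where "signed k a = (if even k then a else - a)"

lemma signed_0 [simp]: "signed 0 a = a"
  and signed_Suc [simp]: "signed (Suc k) a = - signed k a"
  and signed_zero [simp]: "signed k 0 = 0"
  by (auto simp: signed_def)

lemma signed_add: "signed k (a + b) = signed k a + signed k b"
  and signed_diff: "signed k (a - b) = signed k a - signed k b"
  by (auto simp: signed_def)

lemma signed_sum: "signed k (\<Sum>i\<in>I. c i) = (\<Sum>i\<in>I. signed k (c i))"
  by (auto simp: signed_def sum_negf)

lemma signed_commute: "signed j (signed k a) = signed k (signed j a)"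
  by (auto simp: signed_def)

lemma lin_ext_signed: "lin_ext f (frag_cmul ((-1) ^ k) c) = signed k (lin_ext f c)"
  by (cases "even k") (auto simp: signed_def lin_ext_minus)

section \<open>Sums over exponent vectors\<close>

definition bits :: "nat \<Rightarrow> nat list set"
  where "bits n = {ks. length ks = n \<and> set ks \<subseteq> {0, 1}}"

lemma sum_bits_0: "(\<Sum>ks\<in>bits 0. F ks) = F []"
  by (simp add: bits_def cong: conj_cong)

text \<open>The sum may be split along any one of its coordinates. The boundary at position $i$ is matched by
  splitting at that coordinate, and the two ends of the telescope by splitting at the first and at the
  last one.\<close>
lemma sum_bits_insert:
  assumes "i \<le> n"
  shows "(\<Sum>ks\<in>bits (Suc n). F ks)
    = (\<Sum>ks\<in>bits n. F (take i ks @ 0 # drop i ks) + F (take i ks @ 1 # drop i ks))"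
proof -
  have bit: "ks ! i = 0 \<or> ks ! i = 1" if "length ks = Suc n" "set ks \<subseteq> {0, 1}" for ks :: "nat list"
    using that assms nth_mem[of i ks] by (metis insertE le_imp_less_Suc singletonD subsetD)
  have "(\<Sum>(ks, b)\<in>bits n \<times> {0, 1}. F (take i ks @ b # drop i ks)) = (\<Sum>ks\<in>bits (Suc n). F ks)"
    by (rule sum.reindex_bij_witness[of _
          "\<lambda>ks. (take i ks @ drop (Suc i) ks, ks ! i)" "\<lambda>(ks, b). take i ks @ b # drop i ks"])
      (use assms bit in \<open>auto simp: bits_def min_def nth_append id_take_nth_drop[symmetric]
         dest: in_set_takeD in_set_dropD\<close>)
  then show ?thesis
    by (simp add: sum.cartesian_product[symmetric])
qed

lemma sum_bits_Suc: "(\<Sum>ks\<in>bits (Suc n). F ks) = (\<Sum>ks\<in>bits n. F (0 # ks) + F (1 # ks))"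
  using sum_bits_insert[of 0 n F] by simp

section \<open>Merging neighbouring arguments of a multilinear map\<close>

definition merge :: "nat \<Rightarrow> 'm::ab_group_add list \<Rightarrow> 'm list"
  where "merge i ms = take i ms @ (ms ! i + ms ! Suc i) # drop (Suc (Suc i)) ms"

lemma multilinear_add_nth:
  assumes "multilinear (length us + Suc (length vs)) f"
  shows "f (us @ (x + y) # vs) = f (us @ x # vs) + f (us @ y # vs)"
  using assms[unfolded multilinear_def, rule_format, of "us @ x # vs" "length us" x y] by simp

lemma multilinear_merge:
  assumes f: "multilinear n f" and ms: "length ms = Suc n" and i: "i < n"
  shows "f (merge i ms)
    = f (take i ms @ drop (Suc i) ms) + f (take (Suc i) ms @ drop (Suc (Suc i)) ms)"
proof -
  have "multilinear (length (take i ms) + Suc (length (drop (Suc (Suc i)) ms))) f"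
    using f ms i by simp
  from multilinear_add_nth[OF this, of "ms ! i" "ms ! Suc i"] show ?thesis
    using ms i by (simp add: merge_def take_Suc_conv_app_nth Cons_nth_drop_Suc add.commute)
qed

text \<open>For a multilinear map the merge of two neighbours is the sum of the two tuples in which one of
  them is deleted. Consecutive merges share a deleted tuple, with opposite signs, so the sum telescopes.
  This is why a multilinear map is a group cocycle of the abelian group $M$.\<close>
lemma alternating_sum_merge:
  assumes f: "multilinear n f" and ms: "length ms = Suc n"
  shows "(\<Sum>i<n. signed i (f (merge i ms))) = f (drop 1 ms) - signed n (f (take n ms))"
proof -
  have "(\<Sum>i<j. signed i (f (merge i ms)))
      = f (drop 1 ms) - signed j (f (take j ms @ drop (Suc j) ms))" if "j \<le> n" for j
    using that
    by (induction j) (auto simp: multilinear_merge[OF f ms] signed_add)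
  from this[of n] show ?thesis using ms by simp
qed

section \<open>Difference coordinates and exponents\<close>

text \<open>The last entry is kept, as if followed by \<open>0\<close>; this is the change of coordinates in $\gamma_n$.\<close>
definition diffs :: "'m::ab_group_add list \<Rightarrow> 'm list"
  where "diffs ms = map2 (-) ms (tl ms @ [0])"

lemma length_diffs [simp]: "length (diffs ms) = length ms"
  by (cases ms) (auto simp: diffs_def)

lemma nth_diffs:
  "j < length ms \<Longrightarrow> diffs ms ! j = ms ! j - (if Suc j < length ms then ms ! Suc j else 0)"
  by (cases ms) (auto simp: diffs_def nth_append nth_tl less_Suc_eq)

text \<open>The list of the $g_j^{k_j}$.\<close>
definition select :: "'g::zero list \<Rightarrow> nat list \<Rightarrow> 'g list"
  where "select gs ks = map2 (\<lambda>g k. if k = 0 then 0 else g) gs ks"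

lemma length_select [simp]: "length (select gs ks) = min (length gs) (length ks)"
  by (simp add: select_def)

lemma select_simps [simp]:
  "select [] ks = []" "select gs [] = []"
  "select (g # gs) (k # ks) = (if k = 0 then 0 else g) # select gs ks"
  by (auto simp: select_def)

lemma select_append:
  "length gs = length ks \<Longrightarrow> select (gs @ gs') (ks @ ks') = select gs ks @ select gs' ks'"
  by (simp add: select_def)

lemma select_nth:
  "j < length gs \<Longrightarrow> j < length ks \<Longrightarrow> select gs ks ! j = (if ks ! j = 0 then 0 else gs ! j)"
  by (simp add: select_def)

definition conjugate :: "'g::group_add \<Rightarrow> 'g \<Rightarrow> 'g"
  where "conjugate h g = - h + g + h"

lemma conjugate_0 [simp]: "conjugate h 0 = 0"
  by (simp add: conjugate_def)

lemma sum_list_conjugate: "sum_list (map (conjugate h) gs) = conjugate h (sum_list gs)"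
  by (induction gs) (simp_all add: conjugate_def add.assoc)

lemma map_nth_interval:
  assumes "b \<le> length ps"
  shows "map (\<lambda>j. ps ! j) [a..<b] = drop a (take b ps)"
  using assms by (intro nth_equalityI) auto

text \<open>The group elements of a generator start at $g_0$, the exponents at $k_1$. Taking the tail aligns the
  two lists, and the product from $g_{a+1}$ to $g_b$ is then the segment between the offsets $a$ and $b$.\<close>
lemma kprod_eq_sum_list:
  assumes "length gs = Suc n" "length ks = n" "b \<le> n"
  shows "kprod gs ks (Suc a) b = sum_list (drop a (take b (select (tl gs) ks)))"
proof -
  have "map (\<lambda>j. if ks ! (j - 1) = 0 then 0 else gs ! j) [Suc a..<Suc b]
    = map (\<lambda>j. select (tl gs) ks ! j) [a..<b]"
    using assms by (intro nth_equalityI) (auto simp: select_nth nth_tl simp del: upt_Suc)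
  also have "\<dots> = drop a (take b (select (tl gs) ks))"
    using assms by (intro map_nth_interval) auto
  finally show ?thesis by (simp only: kprod_def)
qed

section \<open>Twisted tuples\<close>

locale twisting = right_module smul
  for smul :: "'m::ab_group_add \<Rightarrow> ('g::group_add \<Rightarrow>\<^sub>0 int) \<Rightarrow> 'm" +
  fixes \<phi> :: "'g \<Rightarrow> 'g"
  assumes phi_add: "\<phi> (g + h) = \<phi> g + \<phi> h"
    and phi_central: "\<phi> g \<in> group_center"
begin

abbreviation act :: "'m \<Rightarrow> 'g \<Rightarrow> 'm"  (infixl "\<cdot>" 80)
  where "m \<cdot> g \<equiv> smul m (gr g)"

lemma act_add [simp]: "(m + n) \<cdot> g = m \<cdot> g + n \<cdot> g"
  by (rule smul_add_left)

lemma act_act: "m \<cdot> g \<cdot> h = m \<cdot> (g + h)"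
proof -
  have "gr (g + h) = gr g * gr h" by (simp add: gr_def mult_single)
  then show ?thesis by (simp add: smul_mult)
qed

lemma zero_act [simp]: "0 \<cdot> g = 0"
  using act_add[of 0 0 g] by simp

lemma act_0 [simp]: "m \<cdot> 0 = m"
  using smul_one[of m] by (simp add: gr_def)

lemma smul_diff_right: "smul m (r - s) = smul m r - smul m s"
  using smul_add_right[of m "r - s" s] by (simp add: algebra_simps)

lemma act_diff: "(m - n) \<cdot> g = m \<cdot> g - n \<cdot> g"
  using smul_add_left[of "m - n" n "gr g"] by (simp add: algebra_simps)

lemma phi_commute: "\<phi> g + h = h + \<phi> g"
  using phi_central[of g] by (auto simp: group_center_def)

lemma phi_left_commute: "\<phi> g + (h + k) = h + (\<phi> g + k)"
  by (metis add.assoc phi_commute)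

lemma phi_0 [simp]: "\<phi> 0 = 0"
  by (metis add.right_neutral add_left_cancel phi_add)

lemma phi_minus: "\<phi> (- g) = - \<phi> g"
  using phi_add[of "- g" g] by (simp add: eq_neg_iff_add_eq_0)

lemma phi_conjugate: "\<phi> (conjugate h g) = \<phi> g"
  by (simp add: conjugate_def phi_add phi_minus add.assoc phi_commute[of g])

text \<open>The tuple $(a_i\, \varphi(p_1 \cdots p_i)\, p_{i+1} \cdots p_n)_{0 \le i \le n}$, for arbitrary
  $p_j \in G$. Treating the $p_j$ as free, instead of as powers $g_j^{k_j}$, makes both kinds of
  faces instances of one insertion.\<close>
definition twist :: "'g list \<Rightarrow> 'm list \<Rightarrow> 'm list"
  where "twist ps as =
    map (\<lambda>i. as ! i \<cdot> (\<phi> (sum_list (take i ps)) + sum_list (drop i ps))) [0..<Suc (length ps)]"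

lemma length_twist [simp]: "length (twist ps as) = Suc (length ps)"
  by (simp add: twist_def)

lemma nth_twist:
  "j \<le> length ps \<Longrightarrow>
    twist ps as ! j = as ! j \<cdot> (\<phi> (sum_list (take j ps)) + sum_list (drop j ps))"
  by (simp add: twist_def nth_append less_Suc_eq_le del: upt_Suc)

text \<open>The separate case $i = 0$ in \<^const>\<open>gk\<close> disappears, as $\varphi$ sends the empty product to the identity.\<close>
lemma gk_eq_twist:
  assumes "length gs = Suc n" "length ks = n"
  shows "map (\<lambda>i. ms ! i \<cdot> gk \<phi> n gs ks i) [0..<Suc n] = twist (select (tl gs) ks) ms"
  using assms
  by (intro nth_equalityI)
    (auto simp: nth_twist gk_def kprod_eq_sum_list[OF assms] kprod_eq_sum_list[OF assms, of _ 0, simplified]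
       simp del: upt_Suc)

text \<open>From the second entry on, the first group element enters only through the common central factor
  $\varphi(p)$. Dually, all entries but the last one have the last group element as common right factor.
  An invariant map takes the same value on these entries for all choices of this element.\<close>
lemma drop_twist_Cons: "drop 1 (twist (p # ps) as) = map (\<lambda>m. m \<cdot> \<phi> p) (drop 1 (twist (0 # ps) as))"
  by (rule nth_equalityI)
    (auto simp: nth_twist act_act phi_add add.assoc phi_commute[of p] phi_left_commute[of p])

lemma take_twist_snoc:
  "take (Suc (length ps)) (twist (ps @ [p]) as)
    = map (\<lambda>m. m \<cdot> p) (take (Suc (length ps)) (twist (ps @ [0]) as))"
  by (rule nth_equalityI) (auto simp: nth_twist act_act add.assoc)

section \<open>Faces of birack generators\<close>

text \<open>The acting element is $(m_i, h)$ with $h$ independent of $g_i$. For $h = g_i$ this is the face built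
  from the biquandle operations; for $h = 0$, the identity of $G$, all entries are unchanged and the
  face just omits entry $i$.\<close>
definition face :: "nat \<Rightarrow> 'g \<Rightarrow> ('m \<times> 'g) list \<Rightarrow> ('m \<times> 'g) list"
  where "face i h xs =
    map (\<lambda>y. under smul \<phi> y (fst (xs ! i), h)) (take i xs)
    @ map (\<lambda>y. over smul \<phi> y (fst (xs ! i), h)) (drop (Suc i) xs)"

lemma under_eq: "under smul \<phi> x (n, h) = (fst x \<cdot> h + n \<cdot> \<phi> h - n \<cdot> h, - h + snd x + h)"
  by (cases x) (simp add: smul_diff_right)

lemma over_eq: "over smul \<phi> x (n, h) = (fst x \<cdot> \<phi> h, snd x)"
  by (cases x) simp

lemma face_0: "face i 0 xs = take i xs @ drop (Suc i) xs"
  by (simp add: face_def under_eq over_eq)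

text \<open>The effect of a face on difference coordinates. The correction term $n(\varphi(h) - h)$ in the under
  operation is common to all entries before position $i$ and cancels in their differences. It
  survives only in the coordinate before the deleted entry, where it produces the middle term. The
  index is that of this coordinate, one less than that of the deleted entry, which is never the first.\<close>
definition diff_face :: "nat \<Rightarrow> 'g \<Rightarrow> 'm list \<Rightarrow> 'm list"
  where "diff_face i h as =
    map (\<lambda>a. a \<cdot> h) (take i as) @ (as ! i \<cdot> h + as ! Suc i \<cdot> \<phi> h)
      # map (\<lambda>a. a \<cdot> \<phi> h) (drop (Suc (Suc i)) as)"

lemma diffs_face:
  assumes "Suc i < length xs"
  shows "diffs (map fst (face (Suc i) h xs)) = diff_face i h (diffs (map fst xs))"
  using assms
  by (intro nth_equalityI)
    (auto simp: diff_face_def face_def nth_diffs nth_append nth_Cons' under_eq over_eq act_diff min_def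
       less_Suc_eq numeral_2_eq_2 Suc_diff_Suc)

lemma tl_snd_face:
  assumes "Suc i < length xs"
  shows "tl (map snd (face (Suc i) h xs))
    = map (conjugate h) (take i (tl (map snd xs))) @ drop (Suc i) (tl (map snd xs))"
  using assms
  by (cases xs) (auto simp: face_def conjugate_def under_eq over_eq take_map drop_map)

text \<open>Twisting turns a face into a merge. On an entry left of the insertion, $h$ followed by a product of
  conjugates $h^{-1} p_j h$ is the product of the $p_j$ followed by $h$, which puts $h$ at its place
  among the $p_j$. An entry to the right is multiplied by the central $\varphi(h)$, which joins the factor $\varphi(p_1 \cdots p_i)$. The
  two summands of the middle coordinate are the two entries adjacent to the insertion.\<close>
lemma twist_diff_face:
  assumes "length as = length us + length vs + 2"
  shows "twist (map (conjugate h) us @ vs) (diff_face (length us) h as)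
    = merge (length us) (twist (us @ h # vs) as)"
    (is "?L = ?R")
proof (rule nth_equalityI)
  show "length ?L = length ?R" by (simp add: merge_def)
next
  fix j assume "j < length ?L"
  then have j: "j \<le> length us + length vs" by simp
  consider "j < length us" | "j = length us" | t where "j = Suc (length us + t)"
    by (metis less_iff_Suc_add linorder_neqE_nat)
  then show "?L ! j = ?R ! j"
  proof cases
    case 1
    then have "?L ! j = as ! j \<cdot> (h + (\<phi> (sum_list (take j us))
        + (conjugate h (sum_list (drop j us)) + sum_list vs)))"
      using assms
      by (simp add: nth_twist diff_face_def nth_append take_map drop_map sum_list_conjugate
          phi_conjugate act_act)
    also have "\<dots> = ?R ! j"
      using 1 assms
      by (simp add: nth_twist merge_def nth_append conjugate_def add.assoc
          phi_left_commute[of "sum_list (take j us)"])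
    finally show ?thesis .
  next
    case 2
    then have "?L ! j = as ! j \<cdot> (h + (\<phi> (sum_list us) + sum_list vs))
        + as ! Suc j \<cdot> (\<phi> h + (\<phi> (sum_list us) + sum_list vs))"
      using assms
      by (simp add: nth_twist diff_face_def nth_append sum_list_conjugate phi_conjugate act_act)
    also have "\<dots> = ?R ! j"
      using 2 assms
      by (simp add: nth_twist merge_def nth_append phi_add add.assoc phi_left_commute[of "sum_list us"])
    finally show ?thesis .
  next
    case 3
    then have "?L ! j = as ! Suc j \<cdot> (\<phi> h + (\<phi> (sum_list us + sum_list (take (Suc t) vs))
        + sum_list (drop (Suc t) vs)))"
      using j assms
      by (simp add: nth_twist diff_face_def nth_append sum_list_conjugate phi_conjugate phi_add act_act)
    also have "\<dots> = ?R ! j"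
      using 3 j assms
      by (simp add: nth_twist merge_def nth_append phi_add add.assoc phi_left_commute[of "sum_list us"])
    finally show ?thesis .
  qed
qed

section \<open>Evaluation on generators\<close>

lemma lin_ext_gp_rels:
  assumes f: "G_invariant smul n f" and r: "r \<in> gp_rels smul n"
  shows "lin_ext f r = 0"
  using r unfolding gp_rels_def
proof induction
  case one
  show ?case by simp
next
  case (incl h)
  then show ?case
    using f by (auto simp: lin_ext_diff G_invariant_def gp_gens_def)
next
  case (inv h)
  then obtain ms g where h: "h = frag_of (map (\<lambda>m. m \<cdot> g) ms) - frag_of ms"
    and ms: "ms \<in> gp_gens n" by blast
  have "Poly_Mapping.keys h \<subseteq> gp_gens n"
    unfolding h by (rule order_trans[OF keys_diff]) (use ms in \<open>auto simp: gp_gens_def\<close>)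
  then show ?case
    using f ms by (simp add: h lin_ext_minus lin_ext_diff G_invariant_def gp_gens_def)
next
  case (eng h1 h2)
  then show ?case by (simp add: lin_ext_add)
qed

text \<open>The linear extension of an invariant map kills the relations, so the image of a coset is a single
  value, and \<^const>\<open>the_elem\<close> picks it.\<close>
lemma gp_induced_gp_class:
  assumes "G_invariant smul n f"
  shows "gp_induced f (gp_class smul n c) = lin_ext f c"
proof -
  have "gp_class smul n c = (\<lambda>r. r + c) ` gp_rels smul n"
    by (auto simp: gp_class_def r_coset_def)
  then have "lin_ext f ` gp_class smul n c = (\<lambda>r. lin_ext f c) ` gp_rels smul n"
    by (auto simp: image_image lin_ext_add lin_ext_gp_rels[OF assms] cong: image_cong)
  moreover have "0 \<in> gp_rels smul n"
    unfolding gp_rels_def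
    using generate.one[of "free_Abelian_group (gp_gens n)"] by simp
  ultimately have "lin_ext f ` gp_class smul n c = {lin_ext f c}" by blast
  then show ?thesis by (simp add: gp_induced_def)
qed

text \<open>The value of $f \circ \psi_n \circ \gamma_n$ on a generator (lemma \<open>Phi_map_frag_of\<close>), computed in
  the abelian group without cosets.\<close>
definition cochain :: "nat \<Rightarrow> ('m list \<Rightarrow> 'a::ab_group_add) \<Rightarrow> ('m \<times> 'g) list \<Rightarrow> 'a"
  where "cochain n f xs = (\<Sum>ks\<in>bits n. signed (sum_list ks)
    (f (twist (select (tl (map snd xs)) ks) (diffs (map fst xs)))))"

lemma Phi_map_frag_extend:
  assumes "G_invariant smul (Suc n) f"
  shows "Phi_map smul \<phi> n f c = lin_ext (\<lambda>xs. Phi_map smul \<phi> n f (frag_of xs)) c"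
  by (simp add: Phi_map_def psi_map_def gp_induced_gp_class[OF assms] gamma_map_def lin_ext_frag_extend)

lemma diffs_eq_gamma:
  assumes "length xs = Suc n"
  shows "map (\<lambda>i. fst (xs ! i) - fst (xs ! Suc i)) [0..<n] @ [fst (xs ! n)] = diffs (map fst xs)"
  using assms by (intro nth_equalityI) (auto simp: nth_diffs nth_append less_Suc_eq)

lemma Phi_map_frag_of:
  assumes f: "G_invariant smul (Suc n) f" and xs: "length xs = Suc n"
  shows "Phi_map smul \<phi> n f (frag_of xs) = cochain n f xs"
proof -
  have "map (\<lambda>i. ms ! i \<cdot> gk \<phi> n (map snd xs) ks i) [0..<Suc n]
      = twist (select (tl (map snd xs)) ks) ms" if "ks \<in> bits n" for ks ms
    using that xs by (intro gk_eq_twist) (auto simp: bits_def)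
  then show ?thesis
    unfolding Phi_map_def psi_map_def gamma_map_def cochain_def comp_apply
      gp_induced_gp_class[OF f] frag_extend_of diffs_eq_gamma[OF xs] case_prod_conv
      lin_ext_sum lin_ext_signed lin_ext_frag_of bits_def[symmetric]
    by (intro sum.cong) simp_all
qed

section \<open>The cocycle condition\<close>

lemma select_insert:
  assumes "length gs = Suc n" "length ks = n" "i \<le> n"
  shows "select gs (take i ks @ b # drop i ks)
    = take i (select (take i gs @ drop (Suc i) gs) ks) @ (if b = 0 then 0 else gs ! i)
      # drop i (select (take i gs @ drop (Suc i) gs) ks)"
  using assms by (intro nth_equalityI) (auto simp: select_nth nth_append nth_Cons' min_def)

text \<open>Here \<open>ps\<close> lists the powers of the group elements that the face keeps, before conjugation;
  \<open>h\<close> takes the place of the omitted one.\<close>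
lemma cochain_face:
  assumes xs: "length xs = Suc (Suc n)" and i: "i \<le> n"
  shows "cochain n f (face (Suc i) h xs) = (\<Sum>ks\<in>bits n. signed (sum_list ks)
    (let gs = tl (map snd xs); ps = select (take i gs @ drop (Suc i) gs) ks in
      f (merge i (twist (take i ps @ h # drop i ps) (diffs (map fst xs))))))"
  unfolding cochain_def
proof (rule sum.cong[OF refl], rule arg_cong[where f = "signed _"])
  fix ks assume "ks \<in> bits n"
  then have ks: "length ks = n" by (simp add: bits_def)
  define gs where "gs = tl (map snd xs)"
  define ps where "ps = select (take i gs @ drop (Suc i) gs) ks"
  have ps: "length ps = n" using xs i ks by (simp add: ps_def gs_def)
  have "select (map (conjugate h) (take i gs) @ drop (Suc i) gs) ks
      = map (conjugate h) (take i ps) @ drop i ps"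
    using xs i ks
    by (intro nth_equalityI) (auto simp: ps_def gs_def select_nth nth_append min_def)
  then have "twist (select (tl (map snd (face (Suc i) h xs))) ks) (diffs (map fst (face (Suc i) h xs)))
      = merge i (twist (take i ps @ h # drop i ps) (diffs (map fst xs)))"
    using xs i ps twist_diff_face[of "diffs (map fst xs)" "take i ps" "drop i ps" h]
    by (simp add: diffs_face tl_snd_face flip: gs_def)
  then show "f (twist (select (tl (map snd (face (Suc i) h xs))) ks)
      (diffs (map fst (face (Suc i) h xs)))) = (let gs = tl (map snd xs);
        ps = select (take i gs @ drop (Suc i) gs) ks
      in f (merge i (twist (take i ps @ h # drop i ps) (diffs (map fst xs)))))"
    by (simp add: Let_def ps_def gs_def)
qed

text \<open>The summand for \<open>h = 0\<close> is the one with exponent $0$ at the new coordinate, the summand for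
  $h = g_{i+1}$ the one with exponent $1$. The minus sign between the faces is the sign of
  the additional exponent.\<close>
lemma cochain_face_difference:
  assumes xs: "length xs = Suc (Suc n)" and i: "i \<le> n"
  shows "cochain n f (face (Suc i) 0 xs) - cochain n f (face (Suc i) (snd (xs ! Suc i)) xs)
    = (\<Sum>ks\<in>bits (Suc n). signed (sum_list ks)
        (f (merge i (twist (select (tl (map snd xs)) ks) (diffs (map fst xs))))))"
proof -
  have sl: "sum_list (take i ks @ b # drop i ks) = b + sum_list ks" for ks and b :: nat
    using sum_list.append[of "take i ks" "drop i ks"] by simp
  have nth: "snd (xs ! Suc i) = tl (map snd xs) ! i" using xs i by (simp add: nth_tl)
  have *: "length ks = n" if "ks \<in> bits n" for ks using that by (simp add: bits_def)
  show ?thesis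
    unfolding sum_bits_insert[OF i] cochain_face[OF xs i] sum_subtractf[symmetric] Let_def
    by (rule sum.cong[OF refl], subst (1 2) select_insert[where n = n])
      (use xs i in \<open>auto simp: sl nth * simp del: sum_list_append\<close>)
qed

lemma G_invariantD:
  "G_invariant smul n f \<Longrightarrow> length ms = n \<Longrightarrow> f (map (\<lambda>m. m \<cdot> g) ms) = f ms"
  by (simp add: G_invariant_def)

text \<open>The two ends of the telescope vanish, because the exponent vectors that differ only in the first,
  respectively the last, coordinate contribute the same value of \<open>f\<close> with opposite signs.\<close>
lemma sum_drop_first_twist:
  assumes f: "G_invariant smul (Suc n) f" and gs: "length gs = Suc n"
  shows "(\<Sum>ks\<in>bits (Suc n). signed (sum_list ks) (f (drop 1 (twist (select gs ks) as)))) = 0"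
proof -
  obtain g gs' where g: "gs = g # gs'" "length gs' = n" using gs by (cases gs) auto
  have "f (drop 1 (twist (g # select gs' ks) as)) = f (drop 1 (twist (0 # select gs' ks) as))"
    if "ks \<in> bits n" for ks
    unfolding drop_twist_Cons[of g]
    by (rule G_invariantD[OF f]) (use that g in \<open>simp add: bits_def\<close>)
  then show ?thesis
    unfolding sum_bits_Suc by (intro sum.neutral) (simp add: g)
qed

lemma sum_drop_last_twist:
  assumes f: "G_invariant smul (Suc n) f" and gs: "length gs = Suc n"
  shows "(\<Sum>ks\<in>bits (Suc n). signed (sum_list ks) (f (take (Suc n) (twist (select gs ks) as)))) = 0"
proof -
  obtain g gs' where g: "gs = gs' @ [g]" "length gs' = n" using gs by (cases gs rule: rev_cases) auto
  have "f (take (Suc n) (twist (select gs' ks @ [g]) as))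
      = f (take (Suc n) (twist (select gs' ks @ [0]) as))"
    if "ks \<in> bits n" for ks
    using take_twist_snoc[of "select gs' ks" g as]
      G_invariantD[OF f, of "take (Suc n) (twist (select gs' ks @ [0]) as)" g] that g
    by (simp add: bits_def)
  moreover have "length gs' = length ks" if "ks \<in> bits n" for ks using that g by (simp add: bits_def)
  ultimately show ?thesis
    unfolding sum_bits_insert[OF order_refl]
    by (intro sum.neutral) (simp add: g select_append bits_def)
qed

lemma cochain_boundary:
  assumes f: "multilinear (Suc n) f" "G_invariant smul (Suc n) f" and xs: "length xs = Suc (Suc n)"
  shows "(\<Sum>i<Suc n. signed i
    (cochain n f (face (Suc i) 0 xs) - cochain n f (face (Suc i) (snd (xs ! Suc i)) xs))) = 0"
proof -
  let ?F = "\<lambda>ks. twist (select (tl (map snd xs)) ks) (diffs (map fst xs))"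
  have len: "length (?F ks) = Suc (Suc n)" if "ks \<in> bits (Suc n)" for ks
    using that xs by (simp add: bits_def)
  have "(\<Sum>i<Suc n. signed i
      (cochain n f (face (Suc i) 0 xs) - cochain n f (face (Suc i) (snd (xs ! Suc i)) xs)))
    = (\<Sum>i<Suc n. \<Sum>ks\<in>bits (Suc n). signed (sum_list ks) (signed i (f (merge i (?F ks)))))"
    by (rule sum.cong[OF refl])
      (use xs in \<open>simp add: cochain_face_difference signed_sum signed_commute\<close>)
  also have "\<dots> = (\<Sum>ks\<in>bits (Suc n).
      signed (sum_list ks) (\<Sum>i<Suc n. signed i (f (merge i (?F ks)))))"
    unfolding signed_sum by (rule sum.swap)
  also have "\<dots> = (\<Sum>ks\<in>bits (Suc n). signed (sum_list ks) (f (drop 1 (?F ks)))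
      - signed (Suc n) (signed (sum_list ks) (f (take (Suc n) (?F ks)))))"
    by (rule sum.cong[OF refl])
      (simp only: alternating_sum_merge[OF f(1) len] signed_diff signed_commute)
  also have "\<dots> = (\<Sum>ks\<in>bits (Suc n). signed (sum_list ks) (f (drop 1 (?F ks))))
      - signed (Suc n) (\<Sum>ks\<in>bits (Suc n). signed (sum_list ks) (f (take (Suc n) (?F ks))))"
    by (simp only: signed_sum sum_subtractf)
  also have "\<dots> = 0"
    using xs by (simp only: sum_drop_first_twist[OF f(2)] sum_drop_last_twist[OF f(2)]
        length_tl length_map) simp
  finally show ?thesis .
qed

theorem birack_cocycle_Phi_map:
  assumes n: "n \<ge> 1" and f: "multilinear (Suc n) f" "G_invariant smul (Suc n) f"
  shows "birack_cocycle smul \<phi> n (Phi_map smul \<phi> n f)"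
  unfolding birack_cocycle_def
proof (intro conjI ballI)
  let ?P = "\<lambda>xs. Phi_map smul \<phi> n f (frag_of xs)"
  have P: "Phi_map smul \<phi> n f c = lin_ext ?P c" for c
    by (rule Phi_map_frag_extend[OF f(2)])
  show "Phi_map smul \<phi> n f \<in> hom (C_BR n) type_group"
  proof (rule homI)
    show "Phi_map smul \<phi> n f (c \<otimes>\<^bsub>C_BR n\<^esub> d)
        = Phi_map smul \<phi> n f c \<otimes>\<^bsub>type_group\<^esub> Phi_map smul \<phi> n f d" for c d
      using lin_ext_add[of ?P c d] by (simp only: C_BR_def mult_free_Abelian_group type_group_simps P[symmetric])
  qed simp
  fix c :: "('m \<times> 'g) list \<Rightarrow>\<^sub>0 int"
  assume "c \<in> carrier (C_BR (Suc n))"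
  then have keys: "length xs = Suc (Suc n)" if "xs \<in> Poly_Mapping.keys c" for xs
    using that by (auto simp: C_BR_def BR_gens_def)
  have face_length: "length (face (Suc i) h xs) = Suc n" if "length xs = Suc (Suc n)" "i \<le> n" for i h xs
    using that by (simp add: face_def)
  have "lin_ext ?P (\<Sum>i=1..Suc n. frag_cmul ((-1) ^ (i - 1))
      (frag_of (face i 0 xs) - frag_of (face i (snd (xs ! i)) xs))) = 0"
    if "xs \<in> Poly_Mapping.keys c" for xs
  proof -
    have "lin_ext ?P (\<Sum>i=1..Suc n. frag_cmul ((-1) ^ (i - 1))
        (frag_of (face i 0 xs) - frag_of (face i (snd (xs ! i)) xs)))
      = (\<Sum>i<Suc n. signed i (?P (face (Suc i) 0 xs) - ?P (face (Suc i) (snd (xs ! Suc i)) xs)))"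
      unfolding lin_ext_sum lin_ext_signed lin_ext_diff lin_ext_frag_of One_nat_def
        sum.atLeast1_atMost_eq by simp
    also have "\<dots> = (\<Sum>i<Suc n. signed i
        (cochain n f (face (Suc i) 0 xs) - cochain n f (face (Suc i) (snd (xs ! Suc i)) xs)))"
      by (rule sum.cong[OF refl])
        (simp add: Phi_map_frag_of[OF f(2)] face_length keys[OF that])
    also have "\<dots> = 0" by (rule cochain_boundary[OF f keys[OF that]])
    finally show ?thesis .
  qed
  then have "lin_ext (\<lambda>xs. lin_ext ?P (\<Sum>i=1..Suc n. frag_cmul ((-1) ^ (i - 1))
      (frag_of (face i 0 xs) - frag_of (face i (snd (xs ! i)) xs)))) c = 0"
    by (rule lin_ext_eq_zero)
  moreover have "BR_boundary smul \<phi> (Suc n) c = frag_extend (\<lambda>xs. \<Sum>i=1..Suc n.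
      frag_cmul ((-1) ^ (i - 1)) (frag_of (face i 0 xs) - frag_of (face i (snd (xs ! i)) xs))) c"
    using n unfolding BR_boundary_def face_0 by (simp add: face_def)
  ultimately show "Phi_map smul \<phi> n f (BR_boundary smul \<phi> (Suc n) c) = 0"
    using P[of "BR_boundary smul \<phi> (Suc n) c"] by (simp only: lin_ext_frag_extend)
qed

section \<open>Closed formulas in low degrees\<close>

lemma phi_p_cancel: "- \<phi> p + (p + (h + (\<phi> p + q))) = p + (h + q)"
proof -
  have "p + (h + (\<phi> p + q)) = \<phi> p + (p + (h + q))"
    by (simp only: phi_left_commute[of p])
  then show ?thesis by simp
qed

lemma phi_q_cancel: "\<phi> q - q + (\<phi> h + (\<phi> p + q)) = \<phi> h + (\<phi> p + \<phi> q)"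
proof -
  have "\<phi> h + (\<phi> p + q) = q + (\<phi> h + \<phi> p)"
    by (simp only: phi_commute[of p q] phi_left_commute[of h q])
  moreover have "\<phi> q + (\<phi> h + \<phi> p) = \<phi> h + (\<phi> p + \<phi> q)"
    by (simp only: phi_commute[of q] add.assoc)
  ultimately show ?thesis by (simp add: diff_conv_add_uminus add.assoc del: add_uminus_conv_diff)
qed

text \<open>In the next two lemmas the common factor $\varphi(p) q$ is split off from all entries and removed by
  invariance. It is chosen to clear \<open>p\<close> from every entry but the first one and \<open>q\<close> from every entry but
  the last one.\<close>
lemma invariant_twist_2:
  assumes "G_invariant smul 3 f"
  shows "f (twist [p, q] [a, b, c]) = f [a \<cdot> (- \<phi> p + p), b, c \<cdot> (\<phi> q + - q)]"
proof -
  have "twist [p, q] [a, b, c] = map (\<lambda>m. m \<cdot> (\<phi> p + q)) [a \<cdot> (- \<phi> p + p), b, c \<cdot> (\<phi> q + - q)]"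
    using phi_p_cancel[of p 0 q] phi_q_cancel[of q 0 p]
    by (simp add: twist_def act_act phi_add add.assoc)
  then show ?thesis
    using G_invariantD[OF assms, of "[a \<cdot> (- \<phi> p + p), b, c \<cdot> (\<phi> q + - q)]" "\<phi> p + q"] by simp
qed

lemma invariant_twist_3:
  assumes "G_invariant smul 4 f"
  shows "f (twist [p, h, q] [a, b, c, d])
    = f [a \<cdot> (- \<phi> p + p) \<cdot> h, b \<cdot> h, c \<cdot> \<phi> h, d \<cdot> (\<phi> q + - q) \<cdot> \<phi> h]"
proof -
  have "twist [p, h, q] [a, b, c, d] = map (\<lambda>m. m \<cdot> (\<phi> p + q))
      [a \<cdot> (- \<phi> p + p) \<cdot> h, b \<cdot> h, c \<cdot> \<phi> h, d \<cdot> (\<phi> q + - q) \<cdot> \<phi> h]"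
    using phi_p_cancel[of p h q] phi_q_cancel[of q h p]
    by (simp add: twist_def act_act phi_add add.assoc phi_left_commute[of p])
  then show ?thesis
    using G_invariantD[OF assms, of
        "[a \<cdot> (- \<phi> p + p) \<cdot> h, b \<cdot> h, c \<cdot> \<phi> h, d \<cdot> (\<phi> q + - q) \<cdot> \<phi> h]" "\<phi> p + q"] by simp
qed

lemma multilinear_diff_first_last:
  assumes f: "multilinear (Suc (Suc (length us))) f"
  shows "f ((x - y) # us @ [z - w])
    = f (x # us @ [z]) - f (y # us @ [z]) - f (x # us @ [w]) + f (y # us @ [w])"
proof -
  have 1: "f (x # us @ [v]) = f ((x - y) # us @ [v]) + f (y # us @ [v])" for v
    using multilinear_add_nth[of "[]" "us @ [v]" f "x - y" y] f by simp
  have 2: "f ((x - y) # us @ [z]) = f ((x - y) # us @ [z - w]) + f ((x - y) # us @ [w])"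
    using multilinear_add_nth[of "(x - y) # us" "[]" f "z - w" w] f by simp
  show ?thesis using 1[of z] 1[of w] 2 by simp
qed

lemma smul_one_minus: "smul m (1 - gr g) = m - m \<cdot> g"
  by (simp add: smul_diff_right smul_one)

lemma Phi_map_2:
  assumes f: "multilinear 3 f" "G_invariant smul 3 f"
  shows "Phi_map smul \<phi> 2 f (frag_of [(m0, g0), (m1, g1), (m2, g2)]) =
    f [smul (m0 - m1) (1 - gr (- \<phi> g1 + g1)), m1 - m2, smul m2 (1 - gr (\<phi> g2 + - g2))]"
proof -
  have "Phi_map smul \<phi> 2 f (frag_of [(m0, g0), (m1, g1), (m2, g2)])
    = cochain 2 f [(m0, g0), (m1, g1), (m2, g2)]"
    using f by (intro Phi_map_frag_of) simp_all
  also have "\<dots> = f (twist [0, 0] [m0 - m1, m1 - m2, m2]) - f (twist [g1, 0] [m0 - m1, m1 - m2, m2])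
      - f (twist [0, g2] [m0 - m1, m1 - m2, m2]) + f (twist [g1, g2] [m0 - m1, m1 - m2, m2])"
    by (simp add: cochain_def numeral_2_eq_2 sum_bits_Suc sum_bits_0 diffs_def)
  finally show ?thesis
    using multilinear_diff_first_last[of "[m1 - m2]" f] f(1)
    by (simp add: invariant_twist_2[OF f(2)] smul_one_minus numeral_3_eq_3)
qed

lemma Phi_map_3:
  assumes f: "multilinear 4 f" "G_invariant smul 4 f"
  shows "Phi_map smul \<phi> 3 f (frag_of [(m0, g0), (m1, g1), (m2, g2), (m3, g3)]) =
    f [smul (m0 - m1) (1 - gr (- \<phi> g1 + g1)), m1 - m2, m2 - m3, smul m3 (1 - gr (\<phi> g3 + - g3))]
    - f [smul (m0 - m1) (1 - gr (- \<phi> g1 + g1)) \<cdot> g2, (m1 - m2) \<cdot> g2, (m2 - m3) \<cdot> \<phi> g2,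
         smul m3 (1 - gr (\<phi> g3 + - g3)) \<cdot> \<phi> g2]"
proof -
  let ?as = "[m0 - m1, m1 - m2, m2 - m3, m3]"
  (* the part of the sum with the middle group element fixed to h *)
  let ?S = "\<lambda>h. f (twist [0, h, 0] ?as) - f (twist [g1, h, 0] ?as)
    - f (twist [0, h, g3] ?as) + f (twist [g1, h, g3] ?as)"
  have "Phi_map smul \<phi> 3 f (frag_of [(m0, g0), (m1, g1), (m2, g2), (m3, g3)])
    = cochain 3 f [(m0, g0), (m1, g1), (m2, g2), (m3, g3)]"
    using f by (intro Phi_map_frag_of) simp_all
  also have "\<dots> = ?S 0 - ?S g2"
    by (simp add: cochain_def numeral_3_eq_3 sum_bits_Suc sum_bits_0 diffs_def)
  finally have "Phi_map smul \<phi> 3 f (frag_of [(m0, g0), (m1, g1), (m2, g2), (m3, g3)]) = ?S 0 - ?S g2" .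
  moreover have "?S h = f [smul (m0 - m1) (1 - gr (- \<phi> g1 + g1)) \<cdot> h, (m1 - m2) \<cdot> h,
      (m2 - m3) \<cdot> \<phi> h, smul m3 (1 - gr (\<phi> g3 + - g3)) \<cdot> \<phi> h]" for h
  proof -
    have *: "f [x - y, b, c, z - w] = f [x, b, c, z] - f [y, b, c, z] - f [x, b, c, w] + f [y, b, c, w]"
      for x y z w b c
      using multilinear_diff_first_last[of "[b, c]" f x y z w] f(1) by (simp add: eval_nat_numeral)
    show ?thesis
      unfolding invariant_twist_3[OF f(2)] smul_one_minus act_diff[of "m0 - m1" _ h]
        act_diff[of m3 _ "\<phi> h"] * by simp
  qed
  (* exponent 0 at the middle coordinate is h = 0, exponent 1 is h = g2 *)
  note this[of 0] this[of g2]
  ultimately show ?thesis by (simp only: act_0 phi_0)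
qed

end

section \<open>The two cocycles\<close>

theorem theorem4p5:
  fixes smul :: "'m::ab_group_add \<Rightarrow> ('g::group_add \<Rightarrow>\<^sub>0 int) \<Rightarrow> 'm"
    and \<phi> :: "'g \<Rightarrow> 'g"
  assumes module: "right_module smul"
    and hom: "\<And>g h. \<phi> (g + h) = \<phi> g + \<phi> h"
    and central: "\<And>g. \<phi> g \<in> group_center"
  shows
   "(\<forall>f :: 'm list \<Rightarrow> 'a::ab_group_add. multilinear 3 f \<and> G_invariant smul 3 f \<longrightarrow>
      birack_cocycle smul \<phi> 2 (Phi_map smul \<phi> 2 f) \<and>
      (\<forall>m0 g0 m1 g1 m2 g2.
        Phi_map smul \<phi> 2 f (frag_of [(m0, g0), (m1, g1), (m2, g2)]) =
          f [smul (m0 - m1) (1 - gr (- \<phi> g1 + g1)),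
             m1 - m2,
             smul m2 (1 - gr (\<phi> g2 + - g2))]))
    \<and>
    (\<forall>f :: 'm list \<Rightarrow> 'a. multilinear 4 f \<and> G_invariant smul 4 f \<longrightarrow>
      birack_cocycle smul \<phi> 3 (Phi_map smul \<phi> 3 f) \<and>
      (\<forall>m0 g0 m1 g1 m2 g2 m3 g3.
        Phi_map smul \<phi> 3 f (frag_of [(m0, g0), (m1, g1), (m2, g2), (m3, g3)]) =
          f [smul (m0 - m1) (1 - gr (- \<phi> g1 + g1)),
             m1 - m2,
             m2 - m3,
             smul m3 (1 - gr (\<phi> g3 + - g3))]
          - f [smul (smul (m0 - m1) (1 - gr (- \<phi> g1 + g1))) (gr g2),
               smul (m1 - m2) (gr g2),
               smul (m2 - m3) (gr (\<phi> g2)),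
               smul (smul m3 (1 - gr (\<phi> g3 + - g3))) (gr (\<phi> g2))]))"
proof -
  interpret twisting smul \<phi>
    using module hom central by (intro twisting.intro twisting_axioms.intro)
  show ?thesis
  proof (intro conjI allI impI; elim conjE)
    fix f :: "'m list \<Rightarrow> 'a"
    show "birack_cocycle smul \<phi> 2 (Phi_map smul \<phi> 2 f)"
      if "multilinear 3 f" "G_invariant smul 3 f"
      using that by (intro birack_cocycle_Phi_map) simp_all
    show "birack_cocycle smul \<phi> 3 (Phi_map smul \<phi> 3 f)"
      if "multilinear 4 f" "G_invariant smul 4 f"
      using that by (intro birack_cocycle_Phi_map) simp_all
  qed (rule Phi_map_2 Phi_map_3; assumption)+
qed

end
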